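(* Let $k\ge 0$ be an integer, let $G_k$ be a semi-bar $k$-visibility graph with $n$ vertices, and let $S_{G_k}$ be any semi-bar $k$-visibility representation of $G_k$ (semi-bars of equal lengths are allowed). Then the number of edges in $G_k$ is $$2(k+1)n-\sum_{j=0}^{k}\bigl(A_j(S_{G_k})+U_j(S_{G_k})+Br_j(S_{G_k})\bigr).$$
   Context: A semi-bar $k$-visibility representation of a graph $G_k=(V,E)$ is a set $S=\{s_v\}_{v\in V}$ of pairwise disjoint horizontal segments (semi-bars) with left endpoints on the $y$-axis such that for all distinct $a,b\in V$: $\{a,b\}\in E$ if and only if all but at most $k$ of the semi-bars lying (vertically) between $s_a$ and $s_b$ are shorter than both $s_a$ and $s_b$. A graph having such a representation is a semi-bar $k$-visibility graph. "Taller" means longer, "height" of a semi-bar means its length, and "above"/"under" refer to the vertical position of the semi-bars. For a set $S$ of semi-bars and an integer $j\ge 0$: $A_j(S)$ is the number of semi-bars in $S$ that are (strictly) taller than all but at most $j$ of the semi-bars above them; $U_j(S)$ is the number of semi-bars in $S$ that are (strictly) taller than all but at most $j$ of the semi-bars under them; $Br_j(S)$ is the number of $j$-bridges in $S$, where a $j$-bridge is an unordered pair $\{s_a,s_b\}$ of distinct semi-bars of the same height such that all but exactly $j$ of the semi-bars between $s_a$ and $s_b$ are shorter than $s_a$. *)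

theory Defs
  imports "HOL-Analysis.Analysis"
begin

definition simple_graph :: "'v set \<Rightarrow> 'v set set \<Rightarrow> bool" where
  "simple_graph V E \<longleftrightarrow> finite V \<and> E \<subseteq> {{a, b} | a b. a \<in> V \<and> b \<in> V \<and> a \<noteq> b}"

text \<open>
  A semi-bar is a horizontal segment with left endpoint on the y-axis; it is encoded by the
  ordinate of the segment and its length (its ``height'').
\<close>

datatype semi_bar = Semi_Bar (bar_pos: real) (bar_height: real)

definition bar_segment :: "semi_bar \<Rightarrow> (real \<times> real) set" where
  "bar_segment s = closed_segment (0, bar_pos s) (bar_height s, bar_pos s)"

definition above :: "semi_bar \<Rightarrow> semi_bar \<Rightarrow> bool" where
  "above t s \<longleftrightarrow> bar_pos s < bar_pos t"

definition under :: "semi_bar \<Rightarrow> semi_bar \<Rightarrow> bool" where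
  "under t s \<longleftrightarrow> bar_pos t < bar_pos s"

definition between :: "semi_bar \<Rightarrow> semi_bar \<Rightarrow> semi_bar \<Rightarrow> bool" where
  "between t a b \<longleftrightarrow> (above t a \<and> under t b) \<or> (above t b \<and> under t a)"

definition shorter :: "semi_bar \<Rightarrow> semi_bar \<Rightarrow> bool" where
  "shorter t s \<longleftrightarrow> bar_height t < bar_height s"

text \<open>
  Throughout, ``all but at most (exactly) j of the semi-bars satisfy P'' is rendered as: the set
  of semi-bars violating P has cardinality at most (exactly) j. All the sets involved are finite.
\<close>

definition semi_bar_k_visible :: "nat \<Rightarrow> semi_bar set \<Rightarrow> semi_bar \<Rightarrow> semi_bar \<Rightarrow> bool" where
  "semi_bar_k_visible k S a b \<longleftrightarrow>
     card {t \<in> S. between t a b \<and> \<not> (shorter t a \<and> shorter t b)} \<le> k"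

text \<open>
  The map \<open>s\<close> assigns to each vertex its semi-bar; the set of semi-bars of the representation
  is \<open>s ` V\<close>. Disjointness of the segments makes \<open>s\<close> injective on \<open>V\<close>.
\<close>

definition semi_bar_k_visibility_representation ::
    "nat \<Rightarrow> 'v set \<Rightarrow> 'v set set \<Rightarrow> ('v \<Rightarrow> semi_bar) \<Rightarrow> bool" where
  "semi_bar_k_visibility_representation k V E s \<longleftrightarrow>
     (\<forall>v\<in>V. bar_height (s v) > 0) \<and>
     (\<forall>a\<in>V. \<forall>b\<in>V. a \<noteq> b \<longrightarrow> bar_segment (s a) \<inter> bar_segment (s b) = {}) \<and>
     (\<forall>a\<in>V. \<forall>b\<in>V. a \<noteq> b \<longrightarrow> ({a, b} \<in> E \<longleftrightarrow> semi_bar_k_visible k (s ` V) (s a) (s b)))"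

definition semi_bar_k_visibility_graph :: "nat \<Rightarrow> 'v set \<Rightarrow> 'v set set \<Rightarrow> bool" where
  "semi_bar_k_visibility_graph k V E \<longleftrightarrow>
     simple_graph V E \<and> (\<exists>s. semi_bar_k_visibility_representation k V E s)"

definition A_count :: "nat \<Rightarrow> semi_bar set \<Rightarrow> nat" where
  "A_count j S = card {s \<in> S. card {t \<in> S. above t s \<and> \<not> shorter t s} \<le> j}"

definition U_count :: "nat \<Rightarrow> semi_bar set \<Rightarrow> nat" where
  "U_count j S = card {s \<in> S. card {t \<in> S. under t s \<and> \<not> shorter t s} \<le> j}"

definition bridges :: "nat \<Rightarrow> semi_bar set \<Rightarrow> semi_bar set set" where
  "bridges j S = {{a, b} | a b. a \<in> S \<and> b \<in> S \<and> a \<noteq> b \<and> bar_height a = bar_height b \<and>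
     card {t \<in> S. between t a b \<and> \<not> shorter t a} = j}"

definition Br_count :: "nat \<Rightarrow> semi_bar set \<Rightarrow> nat" where
  "Br_count j S = card (bridges j S)"

end

theory Submission
  imports Defs
begin

text \<open>
  Orient each edge from the not taller to the not shorter semi-bar. The edges leaving \<open>a\<close> upwards
  lead exactly to the lowest \<open>k + 1\<close> of the \<open>m\<close> semi-bars above \<open>a\<close> that are not shorter than \<open>a\<close>
  (to all of them if \<open>m \<le> k\<close>), so there are \<open>min (k + 1) m\<close> of them; the deficit to \<open>k + 1\<close> is the
  number of \<open>j \<le> k\<close> with \<open>m \<le> j\<close>, that is, the contribution of \<open>a\<close> to the sum of the \<open>A_count j\<close>.
  Downwards the same holds with \<open>U_count\<close>. An edge between semi-bars of equal height is
  counted in both orientations, and these edges are the \<open>j\<close>-bridges with \<open>j \<le> k\<close>.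
\<close>

text \<open>The rank of \<open>t\<close>, the number of elements with a smaller
  \<open>f\<close>-value, is injective on \<open>T\<close> and less than \<open>card T\<close>, so
  the ranks are exactly \<open>{..<card T}\<close>; those up to \<open>k\<close> are counted
  there.\<close>

lemma card_rank_le:
  fixes f :: "'a \<Rightarrow> 'b :: linorder"
  assumes "finite T" and inj: "inj_on f T"
  shows "card {t \<in> T. card {u \<in> T. f u < f t} \<le> k} = min (Suc k) (card T)"
proof -
  define r where "r t = card {u \<in> T. f u < f t}" for t
  have less: "r t < r t'" if "t \<in> T" "t' \<in> T" "f t < f t'" for t t'
    unfolding r_def using that \<open>finite T\<close> by (intro psubset_card_mono) auto
  have inj_r: "inj_on r T"
    by (rule inj_onI) (metis inj inj_onD less less_irrefl linorder_cases)
  have "r t < card T" if "t \<in> T" for t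
    unfolding r_def using that \<open>finite T\<close> by (intro psubset_card_mono) auto
  then have image: "r ` T = {..<card T}"
    using card_image[OF inj_r] by (intro card_subset_eq) auto
  have "card {t \<in> T. r t \<le> k} = card (r ` {t \<in> T. r t \<le> k})"
    using inj_r by (intro card_image[symmetric] inj_on_subset[OF inj_r]) auto
  also have "r ` {t \<in> T. r t \<le> k} = r ` T \<inter> {..k}"
    by auto
  also have "\<dots> = {..<min (Suc k) (card T)}"
    unfolding image by auto
  finally show ?thesis
    by (simp add: r_def)
qed

text \<open>Double counting: each \<open>s\<close> occurs for the \<open>j \<le> k\<close> with
  \<open>m s \<le> j\<close>, and their number is the deficit of \<open>min (Suc k) (m s)\<close> to
  \<open>Suc k\<close>. The additive form avoids truncated subtraction on
  \<open>nat\<close>.\<close>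

lemma sum_card_le:
  fixes m :: "'a \<Rightarrow> nat"
  assumes "finite S"
  shows "(\<Sum>j\<le>k. card {s \<in> S. m s \<le> j}) + (\<Sum>s\<in>S. min (Suc k) (m s)) = Suc k * card S"
proof -
  have deficit: "(\<Sum>j\<le>k. of_bool (m s \<le> j)) + min (Suc k) (m s) = Suc k" for s
    \<comment> \<open>The rule removed here would turn the sum into a cardinality before its last
      summand is split off.\<close>
    by (induction k) (auto simp del: sum_of_bool_eq)
  have "(\<Sum>j\<le>k. card {s \<in> S. m s \<le> j}) = (\<Sum>j\<le>k. \<Sum>s\<in>S. of_bool (m s \<le> j))"
    using assms by (simp add: Int_def)
  also have "\<dots> = (\<Sum>s\<in>S. \<Sum>j\<le>k. of_bool (m s \<le> j))"
    by (rule sum.swap)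
  finally show ?thesis
    using deficit by (simp flip: sum.distrib)
qed

text \<open>Each fibre of the map to unordered pairs is \<open>{(a, b), (b, a)}\<close>, and
  irreflexivity makes these two distinct.\<close>

lemma card_sym_irrefl:
  assumes "finite R" and "sym R" and "irrefl R"
  shows "card R = 2 * card ((\<lambda>(a, b). {a, b}) ` R)"
proof -
  let ?p = "\<lambda>(a, b). {a, b}"
  have "card {x \<in> R. ?p x = e} = 2" if e: "e \<in> ?p ` R" for e
  proof -
    obtain a b where ab: "(a, b) \<in> R" "e = {a, b}"
      using e by auto
    then have "{x \<in> R. ?p x = e} = {(a, b), (b, a)}"
      using \<open>sym R\<close> by (auto simp: doubleton_eq_iff dest: symD)
    moreover have "a \<noteq> b"
      using ab \<open>irrefl R\<close> by (auto simp: irrefl_def)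
    ultimately show ?thesis by simp
  qed
  then have "(\<Sum>e\<in>?p ` R. card {x \<in> R. ?p x = e}) = 2 * card (?p ` R)"
    by simp
  moreover have "card R = (\<Sum>e\<in>?p ` R. card {x \<in> R. ?p x = e})"
    using sum.image_gen[OF \<open>finite R\<close>, of "\<lambda>_. 1 :: nat" ?p] by simp
  ultimately show ?thesis by simp
qed

lemma between_commute: "between t a b \<longleftrightarrow> between t b a"
  by (auto simp: between_def)

lemma semi_bar_k_visible_commute: "semi_bar_k_visible k S a b \<longleftrightarrow> semi_bar_k_visible k S b a"
  unfolding semi_bar_k_visible_def by (simp add: between_commute conj_commute)

text \<open>A semi-bar shorter than \<open>a\<close> is then also shorter than \<open>b\<close>, so
  obstruction depends on the height of \<open>a\<close> alone, as in \<open>bridges\<close>.\<close>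

lemma semi_bar_k_visible_if_le:
  assumes "bar_height a \<le> bar_height b"
  shows "semi_bar_k_visible k S a b \<longleftrightarrow> card {t \<in> S. between t a b \<and> \<not> shorter t a} \<le> k"
proof -
  have "{t \<in> S. between t a b \<and> \<not> (shorter t a \<and> shorter t b)} =
      {t \<in> S. between t a b \<and> \<not> shorter t a}"
    using assms by (auto simp: shorter_def)
  then show ?thesis by (simp add: semi_bar_k_visible_def)
qed

text \<open>The obstructions between \<open>a\<close> and \<open>b\<close> are the elements of
  \<open>?T\<close> below \<open>b\<close>, so \<open>b\<close> is visible iff its rank by ordinate
  in \<open>?T\<close> is at most \<open>k\<close>.\<close>

lemma card_visible_above:
  assumes "finite S" and "inj_on bar_pos S"
  shows "card {b \<in> S. above b a \<and> \<not> shorter b a \<and> semi_bar_k_visible k S a b} =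
    min (Suc k) (card {t \<in> S. above t a \<and> \<not> shorter t a})"
proof -
  let ?T = "{t \<in> S. above t a \<and> \<not> shorter t a}"
  have "{t \<in> S. between t a b \<and> \<not> shorter t a} = {t \<in> ?T. bar_pos t < bar_pos b}"
    if "above b a" for b
    using that by (auto simp: between_def above_def under_def)
  then have "{b \<in> S. above b a \<and> \<not> shorter b a \<and> semi_bar_k_visible k S a b} =
      {b \<in> ?T. card {t \<in> ?T. bar_pos t < bar_pos b} \<le> k}"
    by (auto simp: semi_bar_k_visible_if_le shorter_def not_less)
  then show ?thesis
    using assms card_rank_le[of ?T bar_pos k] by (simp add: inj_on_def)
qed

lemma card_visible_under:
  assumes "finite S" and "inj_on bar_pos S"
  shows "card {b \<in> S. under b a \<and> \<not> shorter b a \<and> semi_bar_k_visible k S a b} =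
    min (Suc k) (card {t \<in> S. under t a \<and> \<not> shorter t a})"
proof -
  let ?T = "{t \<in> S. under t a \<and> \<not> shorter t a}"
  \<comment> \<open>Negated ordinates rank the semi-bars under \<open>a\<close> starting from the
    one nearest to \<open>a\<close>.\<close>
  have "{t \<in> S. between t a b \<and> \<not> shorter t a} = {t \<in> ?T. - bar_pos t < - bar_pos b}"
    if "under b a" for b
    using that by (auto simp: between_def above_def under_def)
  then have "{b \<in> S. under b a \<and> \<not> shorter b a \<and> semi_bar_k_visible k S a b} =
      {b \<in> ?T. card {t \<in> ?T. - bar_pos t < - bar_pos b} \<le> k}"
    by (auto simp: semi_bar_k_visible_if_le shorter_def not_less)
  then show ?thesis
    using assms card_rank_le[of ?T "\<lambda>t. - bar_pos t" k] by (simp add: inj_on_def)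
qed

text \<open>Ordered pairs hold each edge in both orientations, so that edges can be grouped by their
  first component.\<close>

definition visible_pairs :: "nat \<Rightarrow> semi_bar set \<Rightarrow> (semi_bar \<times> semi_bar) set" where
  "visible_pairs k S = {(a, b). a \<in> S \<and> b \<in> S \<and> a \<noteq> b \<and> semi_bar_k_visible k S a b}"

lemma finite_visible_pairs: "finite S \<Longrightarrow> finite (visible_pairs k S)"
  by (rule finite_subset[of _ "S \<times> S"]) (auto simp: visible_pairs_def)

lemma card_visible_pairs_not_shorter:
  assumes "finite S" and "inj_on bar_pos S"
  shows "card {(a, b) \<in> visible_pairs k S. \<not> shorter b a}
    + (\<Sum>j\<le>k. A_count j S + U_count j S) = 2 * Suc k * card S"
proof -
  let ?up = "\<lambda>a. {b \<in> S. above b a \<and> \<not> shorter b a \<and> semi_bar_k_visible k S a b}"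
  let ?down = "\<lambda>a. {b \<in> S. under b a \<and> \<not> shorter b a \<and> semi_bar_k_visible k S a b}"
  \<comment> \<open>Distinct ordinates let the partners of each \<open>a\<close> split into those
    above and those under it, each side giving one \<open>Suc k\<close>.\<close>
  have pos: "a \<noteq> b \<longleftrightarrow> above b a \<or> under b a" if "a \<in> S" "b \<in> S" for a b
    using that inj_onD[OF assms(2)] unfolding above_def under_def by (metis less_irrefl linorder_cases)
  have "{(a, b) \<in> visible_pairs k S. \<not> shorter b a} = (SIGMA a:S. ?up a \<union> ?down a)"
    using pos by (auto simp: visible_pairs_def)
  moreover have "card (?up a \<union> ?down a) = card (?up a) + card (?down a)" for a
    using assms(1) by (intro card_Un_disjoint) (auto simp: above_def under_def)
  ultimately have "card {(a, b) \<in> visible_pairs k S. \<not> shorter b a} =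
      (\<Sum>a\<in>S. card (?up a)) + (\<Sum>a\<in>S. card (?down a))"
    using assms(1) by (simp add: sum.distrib)
  then show ?thesis
    using sum_card_le[OF assms(1),
        where k = k and m = "\<lambda>a. card {t \<in> S. above t a \<and> \<not> shorter t a}"]
      sum_card_le[OF assms(1),
        where k = k and m = "\<lambda>a. card {t \<in> S. under t a \<and> \<not> shorter t a}"]
    by (simp add: card_visible_above[OF assms] card_visible_under[OF assms]
        A_count_def U_count_def sum.distrib)
qed

text \<open>For equal heights the number of obstructions is the \<open>j\<close> of the bridge, and
  visibility says \<open>j \<le> k\<close>.\<close>

lemma sum_Br_count:
  assumes "finite S"
  shows "(\<Sum>j\<le>k. Br_count j S) =
    card ((\<lambda>(a, b). {a, b}) ` {(a, b) \<in> visible_pairs k S. bar_height a = bar_height b})"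
proof -
  have "finite (bridges j S)" for j
    by (rule finite_subset[of _ "Pow S"]) (use assms in \<open>auto simp: bridges_def\<close>)
  \<comment> \<open>With equal heights the count does not depend on which of the two semi-bars is
    named first, so the unordered pair determines \<open>j\<close>.\<close>
  moreover have "i = j" if "e \<in> bridges i S" "e \<in> bridges j S" for e i j
    using that by (auto simp: bridges_def doubleton_eq_iff between_commute shorter_def)
  then have "bridges i S \<inter> bridges j S = {}" if "i \<noteq> j" for i j
    using that by blast
  ultimately have "(\<Sum>j\<le>k. Br_count j S) = card (\<Union>j\<le>k. bridges j S)"
    unfolding Br_count_def by (intro card_UN_disjoint[symmetric]) auto
  also have "(\<Union>j\<le>k. bridges j S) =
      (\<lambda>(a, b). {a, b}) ` {(a, b) \<in> visible_pairs k S. bar_height a = bar_height b}"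
    by (fastforce simp: bridges_def visible_pairs_def semi_bar_k_visible_if_le)
  finally show ?thesis .
qed

lemma card_visible_edges:
  assumes "finite S" and "inj_on bar_pos S"
  shows "card ((\<lambda>(a, b). {a, b}) ` visible_pairs k S)
    + (\<Sum>j\<le>k. A_count j S + U_count j S + Br_count j S) = 2 * Suc k * card S"
proof -
  let ?C = "visible_pairs k S"
  let ?P = "{(a, b) \<in> ?C. \<not> shorter b a}"
  let ?D = "{(a, b) \<in> ?C. bar_height a = bar_height b}"
  have fin: "finite ?C" "finite ?P" "finite ?D"
    using finite_visible_pairs[OF assms(1), of k] by (auto intro: finite_subset[rotated])
  have sym: "sym ?C" "sym ?D" and irrefl: "irrefl ?C" "irrefl ?D"
    by (auto simp: visible_pairs_def sym_def irrefl_def semi_bar_k_visible_commute)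
  have un: "?P \<union> ?P\<inverse> = ?C"
    using symD[OF sym(1)] by (auto simp: shorter_def)
  have int: "?P \<inter> ?P\<inverse> = ?D"
    using symD[OF sym(1)] by (auto simp: shorter_def)
  \<comment> \<open>Inclusion-exclusion for \<open>?P\<close> and its converse; \<open>?C\<close>
    and \<open>?D\<close> both count unordered pairs twice, so the equation can be halved.\<close>
  have "2 * card ?P = card ?C + card ?D"
    using card_Un_Int[OF fin(2), of "?P\<inverse>"] fin(2) unfolding un int by simp
  then have "card ?P = card ((\<lambda>(a, b). {a, b}) ` ?C) + (\<Sum>j\<le>k. Br_count j S)"
    using card_sym_irrefl[OF fin(1) sym(1) irrefl(1)] card_sym_irrefl[OF fin(3) sym(2) irrefl(2)]
      sum_Br_count[OF assms(1), of k] by linarith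
  then show ?thesis
    using card_visible_pairs_not_shorter[OF assms, of k] by (simp add: sum.distrib)
qed

text \<open>Two semi-bars with the same ordinate share their left endpoint on the y-axis.\<close>

lemma disjoint_bar_segments_imp_bar_pos_neq:
  assumes "bar_segment a \<inter> bar_segment b = {}"
  shows "bar_pos a \<noteq> bar_pos b"
  using assms ends_in_segment(1) unfolding bar_segment_def by (metis disjoint_iff)

theorem theorem17:
  fixes k n :: nat and V :: "'v set" and E :: "'v set set" and s :: "'v \<Rightarrow> semi_bar"
  assumes "semi_bar_k_visibility_graph k V E"
    and "card V = n"
    and "semi_bar_k_visibility_representation k V E s"
  shows "int (card E) = 2 * (int k + 1) * int n
    - (\<Sum>j=0..k. int (A_count j (s ` V)) + int (U_count j (s ` V)) + int (Br_count j (s ` V)))"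
proof -
  have "finite V" and E: "E \<subseteq> {{a, b} | a b. a \<in> V \<and> b \<in> V \<and> a \<noteq> b}"
    using assms(1) by (auto simp: semi_bar_k_visibility_graph_def simple_graph_def)
  have disjoint: "bar_segment (s a) \<inter> bar_segment (s b) = {}"
    and edge: "{a, b} \<in> E \<longleftrightarrow> semi_bar_k_visible k (s ` V) (s a) (s b)"
    if "a \<in> V" "b \<in> V" "a \<noteq> b" for a b
    using assms(3) that by (auto simp: semi_bar_k_visibility_representation_def)
  have pos: "bar_pos (s a) \<noteq> bar_pos (s b)" if "a \<in> V" "b \<in> V" "a \<noteq> b" for a b
    using disjoint[OF that] by (rule disjoint_bar_segments_imp_bar_pos_neq)
  have inj: "inj_on s V"
    using pos by (metis inj_onI)
  have inj_pos: "inj_on bar_pos (s ` V)"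
    using pos by (auto simp: inj_on_def)
  \<comment> \<open>This carries the edges over from pairs of vertices to pairs of semi-bars, where
    the counting took place.\<close>
  have "(`) s ` E = (\<lambda>(a, b). {a, b}) ` visible_pairs k (s ` V)"
  proof (intro equalityI subsetI)
    fix e assume "e \<in> (`) s ` E"
    then obtain d where d: "d \<in> E" "e = s ` d"
      by blast
    then obtain a b where ab: "d = {a, b}" "a \<in> V" "b \<in> V" "a \<noteq> b"
      using E by blast
    then have "(s a, s b) \<in> visible_pairs k (s ` V)"
      using d edge inj by (simp add: visible_pairs_def inj_on_eq_iff)
    moreover have "e = (\<lambda>(a, b). {a, b}) (s a, s b)"
      using ab d by simp
    ultimately show "e \<in> (\<lambda>(a, b). {a, b}) ` visible_pairs k (s ` V)"
      by (rule rev_image_eqI)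
  next
    fix e assume "e \<in> (\<lambda>(a, b). {a, b}) ` visible_pairs k (s ` V)"
    then obtain a b where ab: "a \<in> V" "b \<in> V" "s a \<noteq> s b"
      "semi_bar_k_visible k (s ` V) (s a) (s b)" "e = {s a, s b}"
      by (auto simp: visible_pairs_def)
    then have "{a, b} \<in> E"
      using edge by auto
    then show "e \<in> (`) s ` E"
      using ab by (intro image_eqI[of _ _ "{a, b}"]) auto
  qed
  \<comment> \<open>Edges are subsets of \<open>V\<close>, and taking images under the injective
    \<open>s\<close> is injective on \<open>Pow V\<close>.\<close>
  moreover have "card ((`) s ` E) = card E"
    using E by (intro card_image inj_on_subset[OF inj_on_image_Pow[OF inj]]) auto
  moreover have "card (s ` V) = n"
    using card_image[OF inj] assms(2) by simp
  ultimately have "card E + (\<Sum>j\<le>k. A_count j (s ` V) + U_count j (s ` V) + Br_count j (s ` V)) =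
      2 * Suc k * n"
    using card_visible_edges[OF finite_imageI[OF \<open>finite V\<close>] inj_pos, of k] by simp
  then have "int (card E) + int (\<Sum>j\<le>k. A_count j (s ` V) + U_count j (s ` V) + Br_count j (s ` V)) =
      int (2 * Suc k * n)"
    by (metis of_nat_add)
  then show ?thesis
    by (simp add: atLeast0AtMost algebra_simps)
qed

end
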